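(* Let $R$ be a domain that is not a field, and suppose $R$ satisfies Condition (E): for every nonzero $x \in R$ there is $y \in R$ such that $yx+1$ is not a unit of $R$. Then: (a) There is an infinite sequence $\{a_n\}_{n=1}^{\infty}$ of pairwise comaximal nonunits of $R$ (that is, $(a_i,a_j)=R$ for all $i\neq j$). (b) If $R$ is also a Furstenberg domain, then $R$ admits an infinite sequence $\{f_n\}_{n=1}^{\infty}$ of pairwise comaximal irreducible elements (that is, $(f_i,f_j)=R$ for all $i \neq j$). Thus $\{(f_n)\}_{n=1}^{\infty}$ is a sequence of distinct atoms of $R$.
   Context: Rings are commutative with $1$; a domain is a nonzero ring without zero divisors. An element of a domain is irreducible if it is a nonzero nonunit $x$ such that $x=yz$ implies $y$ or $z$ is a unit. An atom of $R$ is a principal ideal $(x)$ generated by an irreducible element $x$. A Furstenberg domain is a domain in which every nonzero nonunit is divisible by some irreducible element. *)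

theory Defs
  imports "HOL-Algebra.Ring_Divisibility"
begin

text \<open>
  Irreducibility is the library's \<^const>\<open>ring_irreducible\<close>, which is phrased via proper factors.
  In a domain it coincides with the usual condition on factorizations:
\<close>

lemma (in domain) ring_irreducible_iff:
  assumes "x \<in> carrier R"
  shows "ring_irreducible x \<longleftrightarrow>
    x \<noteq> \<zero> \<and> x \<notin> Units R \<and>
    (\<forall>y\<in>carrier R. \<forall>z\<in>carrier R. x = y \<otimes> z \<longrightarrow> y \<in> Units R \<or> z \<in> Units R)"
proof
  assume "ring_irreducible x"
  then show "x \<noteq> \<zero> \<and> x \<notin> Units R \<and>
      (\<forall>y\<in>carrier R. \<forall>z\<in>carrier R. x = y \<otimes> z \<longrightarrow> y \<in> Units R \<or> z \<in> Units R)"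
    using ring_irreducibleE[OF assms] by blast
next
  assume "x \<noteq> \<zero> \<and> x \<notin> Units R \<and>
      (\<forall>y\<in>carrier R. \<forall>z\<in>carrier R. x = y \<otimes> z \<longrightarrow> y \<in> Units R \<or> z \<in> Units R)"
  then show "ring_irreducible x"
    using assms by (intro ring_irreducibleI) auto
qed

definition atoms :: "('a, 'b) ring_scheme \<Rightarrow> 'a set set"
  where "atoms R = {PIdl\<^bsub>R\<^esub> x | x. x \<in> carrier R \<and> ring_irreducible\<^bsub>R\<^esub> x}"

locale furstenberg_domain = domain +
  assumes irreducible_divisor:
    "\<lbrakk>x \<in> carrier R; x \<noteq> \<zero>; x \<notin> Units R\<rbrakk> \<Longrightarrow>
      \<exists>p\<in>carrier R. ring_irreducible p \<and> p divides x"

definition condition_E :: "('a, 'b) ring_scheme \<Rightarrow> bool"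
  where "condition_E R \<longleftrightarrow>
    (\<forall>x\<in>carrier R - {\<zero>\<^bsub>R\<^esub>}. \<exists>y\<in>carrier R. y \<otimes>\<^bsub>R\<^esub> x \<oplus>\<^bsub>R\<^esub> \<one>\<^bsub>R\<^esub> \<notin> Units R)"

definition pairwise_comaximal :: "('a, 'b) ring_scheme \<Rightarrow> (nat \<Rightarrow> 'a) \<Rightarrow> bool"
  where "pairwise_comaximal R a \<longleftrightarrow> (\<forall>i j. i \<noteq> j \<longrightarrow> Idl\<^bsub>R\<^esub> {a i, a j} = carrier R)"

end

theory Submission
  imports Defs
begin

text \<open>
  Euclid's argument: given pairwise comaximal nonzero nonunits with product \<open>x\<close>, Condition (E)
  provides \<open>y\<close> such that \<open>y x + 1\<close> is a nonunit, and any divisor of it is comaximal with every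
  factor of \<open>x\<close>. As \<open>R\<close> is not a field, the construction can start from a nonunit; then \<open>x\<close> is
  always a nonunit, so \<open>y x + 1\<close> is nonzero and has an irreducible divisor in a Furstenberg domain.
\<close>

lemma (in domain) not_field_imp_nonzero_nonunit:
  assumes "\<not> field R"
  shows "\<exists>x\<in>carrier R. x \<noteq> \<zero> \<and> x \<notin> Units R"
proof (rule ccontr)
  assume "\<not> ?thesis"
  moreover have "\<zero> \<notin> Units R"
    using zero_is_prime(1) by (auto simp: Units_def)
  ultimately have "Units R = carrier R - {\<zero>}"
    by (auto simp: Units_def)
  then show False
    using assms cring_fieldI by blast
qed

text \<open>The ideal contains \<open>x\<close> and \<open>y \<otimes> x \<oplus> \<one>\<close>,
  hence their combination \<open>\<one>\<close>. Here \<open>a\<close> stands for an earlier term of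
  the sequence and \<open>b\<close> for a later one.\<close>

lemma (in cring) genideal_pair_eq_carrier:
  assumes "a \<in> carrier R" "b \<in> carrier R" "x \<in> carrier R" "y \<in> carrier R"
    and "a divides x" "b divides (y \<otimes> x \<oplus> \<one>)"
  shows "Idl {a, b} = carrier R"
proof -
  interpret I: ideal "Idl {a, b}" R
    using assms by (intro genideal_ideal) auto
  have ab: "a \<in> Idl {a, b}" "b \<in> Idl {a, b}"
    using genideal_self[of "{a, b}"] assms by auto
  have "x \<in> Idl {a, b}"
    using assms(5) I.I_r_closed[OF ab(1)] by (metis dividesE)
  moreover have "y \<otimes> x \<oplus> \<one> \<in> Idl {a, b}"
    using assms(6) I.I_r_closed[OF ab(2)] by (metis dividesE)
  ultimately have "\<ominus> (y \<otimes> x) \<oplus> (y \<otimes> x \<oplus> \<one>) \<in> Idl {a, b}"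
    using assms by (meson I.I_l_closed I.a_closed I.a_inv_closed)
  moreover have "\<ominus> (y \<otimes> x) \<oplus> (y \<otimes> x \<oplus> \<one>) = \<one>"
    using assms by (simp add: r_neg1)
  ultimately show ?thesis
    using I.one_imp_carrier by simp
qed

text \<open>If the two principal ideals agreed, both generators would lie in \<open>PIdl a\<close>,
  so \<open>PIdl a\<close> would contain \<open>\<one>\<close> and \<open>a\<close> would be a
  unit.\<close>

lemma (in cring) comaximal_nonunit_cgenideal_neq:
  assumes "a \<in> carrier R" "b \<in> carrier R" "a \<notin> Units R" "Idl {a, b} = carrier R"
  shows "PIdl a \<noteq> PIdl b"
proof
  assume "PIdl a = PIdl b"
  then have "Idl {a, b} \<subseteq> PIdl a"
    using assms cgenideal_self by (intro genideal_minimal cgenideal_ideal) auto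
  then have "\<one> \<in> PIdl a"
    using assms by auto
  then obtain c where "c \<in> carrier R" "\<one> = c \<otimes> a"
    by (auto simp: cgenideal_def)
  then show False
    using assms(1,3) unit_factor[of a c] m_comm[of c a] Units_one_closed by metis
qed

text \<open>The predicate \<open>P\<close> lets one construction serve both claims: it is
  instantiated with the nonzero nonunits for the first and with the irreducible elements for the
  second.\<close>

lemma (in domain) comaximal_sequence_of_divisors:
  assumes E: "condition_E R" and "\<not> field R"
    and P: "\<And>p. P p \<Longrightarrow> p \<in> carrier R \<and> p \<noteq> \<zero> \<and> p \<notin> Units R"
    and dvd: "\<And>x. \<lbrakk>x \<in> carrier R; x \<noteq> \<zero>; x \<notin> Units R\<rbrakk> \<Longrightarrow> \<exists>p. P p \<and> p divides x"
  shows "\<exists>f :: nat \<Rightarrow> 'a. (\<forall>n. P (f n)) \<and> pairwise_comaximal R f"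
proof -
  \<comment> \<open>A state is a pair: the newest term and a running common multiple of all terms so
    far. \<open>Q\<close> is the invariant of a single state.\<close>
  define Q where "Q s \<longleftrightarrow> P (fst s) \<and> snd s \<in> carrier R \<and> snd s \<noteq> \<zero> \<and> snd s \<notin> Units R
    \<and> fst s divides snd s" for s :: "'a \<times> 'a"
  \<comment> \<open>The transition keeps all old divisors of the running multiple and makes the new
    term a divisor of an Euclid number built from the old multiple.\<close>
  define N where "N s t \<longleftrightarrow> snd s divides snd t
    \<and> (\<exists>y\<in>carrier R. fst t divides (y \<otimes> snd s \<oplus> \<one>))" for s t :: "'a \<times> 'a"
  have start: "\<exists>s. Q s"
  proof -
    obtain x p where "P p" "x \<in> carrier R" "x \<noteq> \<zero>" "x \<notin> Units R" "p divides x"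
      using not_field_imp_nonzero_nonunit[OF \<open>\<not> field R\<close>] dvd by blast
    then have "Q (p, x)"
      by (simp add: Q_def)
    then show ?thesis ..
  qed
  have step: "\<exists>t. Q t \<and> N s t" if "Q s" for s
  proof -
    define x where "x = snd s"
    have x: "x \<in> carrier R" "x \<noteq> \<zero>" "x \<notin> Units R"
      using that by (auto simp: Q_def x_def)
    obtain y where y: "y \<in> carrier R" "y \<otimes> x \<oplus> \<one> \<notin> Units R"
      using E x unfolding condition_E_def by blast
    \<comment> \<open>Otherwise \<open>\<ominus> y\<close> would be an inverse of the nonunit
      \<open>x\<close>.\<close>
    have "y \<otimes> x \<oplus> \<one> \<noteq> \<zero>"
    proof
      assume "y \<otimes> x \<oplus> \<one> = \<zero>"
      then have "\<ominus> (y \<otimes> x) = \<one>"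
        using x y by (intro minus_equality) (auto simp: a_comm)
      then have "\<ominus> y \<otimes> x = \<one>"
        using x y by (simp add: l_minus)
      then show False
        using x y unit_factor[of x "\<ominus> y"] by (simp add: m_comm)
    qed
    then obtain p where p: "P p" "p divides (y \<otimes> x \<oplus> \<one>)"
      using dvd[of "y \<otimes> x \<oplus> \<one>"] x y by auto
    have pc: "p \<in> carrier R" "p \<noteq> \<zero>"
      using P p by auto
    \<comment> \<open>The new running multiple is \<open>x \<otimes> p\<close>; it inherits being a
      nonunit from its factor \<open>x\<close>.\<close>
    have "x \<otimes> p \<notin> Units R"
      using x pc unit_factor by blast
    moreover have "p divides x \<otimes> p"
      using x pc by (intro dividesI[of x]) (simp_all add: m_comm)
    ultimately have "Q (p, x \<otimes> p)"
      using p pc x by (simp add: Q_def integral_iff)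
    moreover have "N s (p, x \<otimes> p)"
      using p pc y unfolding N_def by (auto simp flip: x_def)
    ultimately show ?thesis by blast
  qed
  have "\<exists>s :: nat \<Rightarrow> 'a \<times> 'a. \<forall>n. Q (s n) \<and> N (s n) (s (Suc n))"
    using start step by (intro dependent_nat_choice)
  then obtain s where s: "Q (s n)" "N (s n) (s (Suc n))" for n :: nat
    by blast
  define f where "f n = fst (s n)" for n
  define x where "x n = snd (s n)" for n
  have f: "P (f n)" "f n \<in> carrier R" and x: "x n \<in> carrier R" for n
    using s(1)[of n] P by (auto simp: f_def x_def Q_def)
  have f_dvd: "f i divides x j" if "i \<le> j" for i j
    using that
  proof (induction j rule: dec_induct)
    case base
    then show ?case using s(1)[of i] by (simp add: Q_def f_def x_def)
  next
    case (step n)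
    moreover have "x n divides x (Suc n)"
      using s(2)[of n] by (simp add: N_def x_def)
    ultimately show ?case
      using divides_trans f by blast
  qed
  have less: "Idl {f i, f j} = carrier R" if "i < j" for i j
  proof -
    \<comment> \<open>The term \<open>f j\<close> was chosen against the multiple of the preceding
      state, \<open>x k\<close> with \<open>k = j - 1\<close>, and \<open>f i\<close> already
      divides that multiple.\<close>
    obtain k where k: "j = Suc k" "i \<le> k"
      using \<open>i < j\<close> by (cases j) auto
    obtain y where "y \<in> carrier R" "f j divides (y \<otimes> x k \<oplus> \<one>)"
      using s(2)[of k] k by (auto simp: N_def f_def x_def)
    then show ?thesis
      by (rule genideal_pair_eq_carrier[OF f(2) f(2) x _ f_dvd[OF k(2)]])
  qed
  have "Idl {f i, f j} = carrier R" if "i \<noteq> j" for i j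
    using that less[of i j] less[of j i] by (cases "i < j") (simp_all add: insert_commute)
  then have "pairwise_comaximal R f"
    by (simp add: pairwise_comaximal_def)
  then show ?thesis
    using f by blast
qed

theorem theorem2p3:
  fixes R (structure)
  assumes "domain R" and "\<not> field R" and "condition_E R"
  shows "(\<exists>a :: nat \<Rightarrow> 'a.
            (\<forall>n. a n \<in> carrier R \<and> a n \<notin> Units R) \<and> pairwise_comaximal R a) \<and>
         (furstenberg_domain R \<longrightarrow>
           (\<exists>f :: nat \<Rightarrow> 'a.
            (\<forall>n. f n \<in> carrier R \<and> ring_irreducible (f n)) \<and> pairwise_comaximal R f \<and>
            (\<forall>n. PIdl (f n) \<in> atoms R) \<and> (\<forall>i j. i \<noteq> j \<longrightarrow> PIdl (f i) \<noteq> PIdl (f j))))"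
proof (intro conjI impI)
  interpret domain R by fact
  \<comment> \<open>With \<open>P\<close> the nonzero nonunits, the required divisor of an element
    is the element itself.\<close>
  have "\<exists>a :: nat \<Rightarrow> 'a. (\<forall>n. a n \<in> carrier R \<and> a n \<noteq> \<zero> \<and> a n \<notin> Units R) \<and>
      pairwise_comaximal R a"
    using assms by (intro comaximal_sequence_of_divisors) auto
  then show "\<exists>a :: nat \<Rightarrow> 'a. (\<forall>n. a n \<in> carrier R \<and> a n \<notin> Units R) \<and> pairwise_comaximal R a"
    by blast
next
  assume "furstenberg_domain R"
  then interpret furstenberg_domain R .
  have "\<exists>f :: nat \<Rightarrow> 'a. (\<forall>n. f n \<in> carrier R \<and> ring_irreducible (f n)) \<and> pairwise_comaximal R f"
  proof (rule comaximal_sequence_of_divisors[OF assms(3,2)])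
    show "p \<in> carrier R \<and> p \<noteq> \<zero> \<and> p \<notin> Units R" if "p \<in> carrier R \<and> ring_irreducible p" for p
      using that ring_irreducible_iff by blast
    show "\<exists>p. (p \<in> carrier R \<and> ring_irreducible p) \<and> p divides x"
      if "x \<in> carrier R" "x \<noteq> \<zero>" "x \<notin> Units R" for x
      using irreducible_divisor[OF that] by blast
  qed
  then obtain f :: "nat \<Rightarrow> 'a" where f: "\<And>n. f n \<in> carrier R" "\<And>n. ring_irreducible (f n)"
    "pairwise_comaximal R f"
    by blast
  \<comment> \<open>Irreducible elements are nonunits, so comaximality separates the atoms they
    generate.\<close>
  have "PIdl (f i) \<noteq> PIdl (f j)" if "i \<noteq> j" for i j
    using that f ring_irreducibleE(4)[OF f(1,2)]
    by (intro comaximal_nonunit_cgenideal_neq) (auto simp: pairwise_comaximal_def)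
  moreover have "PIdl (f n) \<in> atoms R" for n
    using f by (auto simp: atoms_def)
  ultimately show "\<exists>f :: nat \<Rightarrow> 'a.
            (\<forall>n. f n \<in> carrier R \<and> ring_irreducible (f n)) \<and> pairwise_comaximal R f \<and>
            (\<forall>n. PIdl (f n) \<in> atoms R) \<and> (\<forall>i j. i \<noteq> j \<longrightarrow> PIdl (f i) \<noteq> PIdl (f j))"
    using f by blast
qed

end
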